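(* For every odd positive integer $n$ and every non-negative integer $i$, the polynomial $$f(x)=x^{\frac{3^n-1}{2}+3^i}+2x^{\frac{3^n-1}{2}+3}+x^{\frac{3^n-1}{2}+2}+2x^{\frac{3^n-1}{2}+1}+2x^{3^i}+2x^3+x^2+2x$$ is a permutation polynomial of $\mathbb{F}_{3^n}$.
   Context: A polynomial is a permutation polynomial (PP) of a finite field if it induces a bijection of that field to itself. *)

theory Defs
  imports "HOL-Computational_Algebra.Polynomial" "HOL-Library.Cardinality"
begin

definition permutation_polynomial :: "'a::{field,finite} poly \<Rightarrow> bool" where
  "permutation_polynomial f \<longleftrightarrow> bij (poly f)"

end

theory Submission imports Defs begin

text \<open>
  Put \<open>q = 3^n\<close> and \<open>h = (q - 1)/2\<close>. Since \<open>n\<close> is odd, \<open>h\<close> is odd and \<open>-1\<close> is a nonsquare.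
  On nonzero squares the polynomial is \<open>x (x + 1)\<^sup>2\<close>, and on nonsquares it is \<open>x^(3^i)\<close>; in both
  cases the value has the same quadratic character as \<open>x\<close>, so it suffices to prove injectivity on
  each class. For squares \<open>x = u\<^sup>2\<close> and \<open>y = v\<^sup>2\<close>, equality of the values means
  \<open>u\<^sup>3 + u = \<plusminus>(v\<^sup>3 + v)\<close>, and \<open>u\<^sup>3 + u\<close> is additive with kernel \<open>{u. u (u\<^sup>2 + 1) = 0} = {0}\<close>.
\<close>

text \<open>Multiplication by \<open>x\<close> permutes the nonzero elements, so it preserves their
  product, which is nonzero and cancels.\<close>

lemma power_card_minus_one_eq_one:
  fixes x :: "'a::{field,finite}"
  assumes "x \<noteq> 0"
  shows "x ^ (CARD('a) - 1) = 1"
proof -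
  let ?S = "UNIV - {0::'a}"
  have "(\<Prod>y\<in>?S. y) = (\<Prod>y\<in>?S. x * y)"
    by (rule prod.reindex_bij_witness[of _ "\<lambda>y. x * y" "\<lambda>y. y / x"]) (use assms in auto)
  also have "\<dots> = x ^ (CARD('a) - 1) * (\<Prod>y\<in>?S. y)"
    by (simp add: prod.distrib card_Diff_singleton)
  finally show ?thesis
    by simp
qed

text \<open>Translation by 1 permutes the ring and so preserves the sum of all elements.\<close>

lemma of_nat_card_eq_zero: "of_nat CARD('a) = (0 :: 'a::{ring_1,finite})"
proof -
  have "(\<Sum>y\<in>UNIV. y) = (\<Sum>y\<in>UNIV. y + (1::'a))"
    by (rule sum.reindex_bij_witness[of _ "\<lambda>y. y + 1" "\<lambda>y. y - 1"]) auto
  also have "\<dots> = (\<Sum>y\<in>UNIV. y) + of_nat CARD('a)"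
    by (simp add: sum.distrib)
  finally show ?thesis
    by simp
qed

lemma cube_diff_char3:
  fixes x y :: "'a::comm_ring_1"
  assumes "(3::'a) = 0"
  shows "(x - y) ^ 3 = x ^ 3 - y ^ 3"
proof -
  have "(x - y) ^ 3 = x ^ 3 - y ^ 3 - 3 * (x * y * (x - y))"
    by (simp add: power3_eq_cube algebra_simps)
  then show ?thesis
    using assms by simp
qed

text \<open>Iterated cubing: \<open>x ^ 3 = y ^ 3\<close> forces
  \<open>(x - y) ^ 3 = 0\<close>.\<close>

lemma inj_power_three_power_char3:
  assumes "(3::'a::idom) = 0"
  shows "inj (\<lambda>x::'a. x ^ 3 ^ i)"
proof (induction i)
  case (Suc i)
  have "inj (\<lambda>x::'a. x ^ 3)"
    by (rule injI) (metis assms cube_diff_char3 eq_iff_diff_eq_0 power_eq_0_iff)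
  then have "inj ((\<lambda>x::'a. x ^ 3) \<circ> (\<lambda>x. x ^ 3 ^ i))"
    using Suc.IH by (rule inj_compose)
  then show ?case
    by (simp only: comp_def power_mult[symmetric] power_Suc2)
qed simp

text \<open>Since 9 is 1 modulo 4, an odd power of 3 is 3 modulo 4.\<close>

lemma odd_half_three_power_minus_one:
  assumes "odd n"
  shows "odd ((3 ^ n - 1) div 2 :: nat)"
proof -
  from assms obtain m where "n = 2 * m + 1"
    by (elim oddE)
  have "(9::nat) ^ m mod 4 = 1"
    by (simp add: power_mod[of 9 4, symmetric])
  then obtain k where "(9::nat) ^ m = 4 * k + 1"
    by (metis mult_div_mod_eq)
  with \<open>n = 2 * m + 1\<close> have "(3::nat) ^ n = 2 * (2 * (3 * k) + 1) + 1"
    by (simp add: power_mult)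
  then show ?thesis
    by simp
qed

theorem theorem1p5:
  fixes n i :: nat
  assumes "odd n"
    and "CARD('a::{field,finite}) = 3 ^ n"
  shows "permutation_polynomial
    (monom 1 ((3 ^ n - 1) div 2 + 3 ^ i)
     + monom 2 ((3 ^ n - 1) div 2 + 3)
     + monom 1 ((3 ^ n - 1) div 2 + 2)
     + monom 2 ((3 ^ n - 1) div 2 + 1)
     + monom 2 (3 ^ i) + monom 2 3 + monom 1 2 + monom 2 1 :: 'a poly)"
  (is "permutation_polynomial ?f")
proof -
  define h :: nat where "h = (3 ^ n - 1) div 2"
  have "odd h"
    unfolding h_def by (rule odd_half_three_power_minus_one) fact
  then have "h > 0"
    by (rule odd_pos)
  have "CARD('a) - 1 = 2 * h"
    using assms(2) by (simp add: h_def)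
  \<comment> \<open>The cardinality \<open>3 ^ n\<close> vanishes in the field, hence so does
    3.\<close>
  have three: "(3::'a) = 0"
    using of_nat_card_eq_zero[where 'a = 'a] assms(2) by simp
  then have two: "(2::'a) = - 1"
    by (simp add: eq_neg_iff_add_eq_0)
  then have neg_one: "(- 1 :: 'a) \<noteq> 1"
    by (metis one_neq_zero add.right_inverse one_add_one)

  have square_char: "(z ^ 2) ^ h = 1" if "z \<noteq> 0" for z :: 'a
    using power_card_minus_one_eq_one[OF that] \<open>CARD('a) - 1 = 2 * h\<close> by (simp flip: power_mult)
  have char_cases: "z = 0 \<or> z ^ h = 1 \<or> z ^ h = - 1" for z :: 'a
    using square_char[of z] by (metis power2_eq_1_iff power_mult mult.commute)
  have neg_one_nonsquare: "u ^ 2 \<noteq> - 1" for u :: 'a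
  proof
    assume "u ^ 2 = - 1"
    moreover from this have "u \<noteq> 0"
      by auto
    ultimately show False
      using square_char[of u] \<open>odd h\<close> neg_one by simp
  qed
  have is_square: "\<exists>u. z = u ^ 2" if "z ^ h = 1" for z :: 'a
  proof -
    obtain k where "h = 2 * k + 1"
      using \<open>odd h\<close> by (elim oddE)
    \<comment> \<open>As \<open>h + 1 = 2 * (k + 1)\<close> and \<open>z ^ h = 1\<close>, a square
      root of \<open>z\<close> is \<open>z ^ (k + 1)\<close>.\<close>
    then have "(z ^ (k + 1)) ^ 2 = z ^ h * z"
      by (simp add: mult_2 power2_eq_square power_add)
    with that show ?thesis
      by (metis mult_1)
  qed

  define f where "f = ?f"
  have f_eq: "poly f z = z ^ h * (z ^ 3 ^ i - z ^ 3 + z ^ 2 - z) - z ^ 3 ^ i - z ^ 3 + z ^ 2 - z" for z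
    unfolding f_def h_def[symmetric]
    by (simp add: poly_monom two power_add power2_eq_square algebra_simps)
  have on_zero: "poly f 0 = 0"
    using \<open>h > 0\<close> by (simp add: f_eq)
  have on_squares: "poly f z = z * (z + 1) ^ 2" if "z ^ h = 1" for z
  proof -
    \<comment> \<open>The terms \<open>z ^ 3 ^ i\<close> cancel, leaving
      \<open>2 * (z ^ 2 - z ^ 3 - z)\<close>.\<close>
    have "poly f z = z * (z + 1) ^ 2 - 3 * (z ^ 3 + z)"
      unfolding f_eq that by (simp add: power2_eq_square power3_eq_cube algebra_simps)
    then show ?thesis
      by (simp add: three)
  qed
  have on_nonsquares: "poly f z = z ^ 3 ^ i" if "z ^ h = - 1" for z
  proof -
    have "poly f z = z ^ 3 ^ i - 3 * z ^ 3 ^ i"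
      unfolding f_eq that by (simp add: algebra_simps)
    then show ?thesis
      by (simp add: three)
  qed

  have char_value: "poly f z ^ h = z ^ h" for z
  proof -
    consider "z = 0" | "z ^ h = 1" | "z ^ h = - 1"
      using char_cases by blast
    then show ?thesis
    proof cases
      case 1
      then show ?thesis by (simp add: on_zero)
    next
      case 2
      \<comment> \<open>Since \<open>(- 1) ^ h = - 1\<close>, the factor \<open>(z + 1) ^ 2\<close>
        is a nonzero square, of character 1.\<close>
      then have "z \<noteq> - 1"
        using \<open>odd h\<close> neg_one by auto
      then have "z + 1 \<noteq> 0"
        by (simp add: eq_neg_iff_add_eq_0)
      with 2 show ?thesis
        by (simp add: on_squares power_mult_distrib square_char)
    next
      case 3
      \<comment> \<open>The exponent \<open>3 ^ i\<close> is odd, so it fixes the character value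
        \<open>- 1\<close>.\<close>
      have "(z ^ 3 ^ i) ^ h = (z ^ h) ^ 3 ^ i"
        by (simp add: mult.commute flip: power_mult)
      with 3 show ?thesis
        by (simp add: on_nonsquares)
    qed
  qed

  have cubic_inj: "u = v" if "u * (u ^ 2 + 1) = v * (v ^ 2 + 1)" for u v :: 'a
  proof -
    \<comment> \<open>By additivity the cubic vanishes at \<open>u - v\<close>; its quadratic factor
      has no root.\<close>
    have "(u - v) * ((u - v) ^ 2 + 1) = (u - v) ^ 3 + (u - v)"
      by (simp add: power2_eq_square power3_eq_cube distrib_left)
    also have "\<dots> = u * (u ^ 2 + 1) - v * (v ^ 2 + 1)"
      unfolding cube_diff_char3[OF three] by (simp add: power2_eq_square power3_eq_cube algebra_simps)
    finally have "(u - v) * ((u - v) ^ 2 + 1) = 0"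
      using that by simp
    with neg_one_nonsquare[of "u - v"] show ?thesis
      by (simp add: eq_neg_iff_add_eq_0)
  qed

  have "inj (poly f)"
  proof (rule injI)
    fix x y
    assume eq: "poly f x = poly f y"
    then have char_eq: "x ^ h = y ^ h"
      by (metis char_value)
    consider "x = 0" | "x ^ h = 1" | "x ^ h = - 1"
      using char_cases by blast
    then show "x = y"
    proof cases
      case 1
      with char_eq \<open>h > 0\<close> show ?thesis
        by (metis power_eq_0_iff)
    next
      case 2
      with char_eq obtain u v where uv: "x = u ^ 2" "y = v ^ 2"
        by (metis is_square)
      from 2 char_eq eq have "x * (x + 1) ^ 2 = y * (y + 1) ^ 2"
        by (simp add: on_squares)
      then have "(u * (u ^ 2 + 1)) ^ 2 = (v * (v ^ 2 + 1)) ^ 2"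
        by (simp add: uv power_mult_distrib)
      \<comment> \<open>The cubic is odd, so the negative sign moves into its argument and
        \<open>cubic_inj\<close> covers both cases.\<close>
      then have "u * (u ^ 2 + 1) = v * (v ^ 2 + 1) \<or> u * (u ^ 2 + 1) = (- v) * ((- v) ^ 2 + 1)"
        by (simp add: power2_eq_iff)
      then have "u = v \<or> u = - v"
        using cubic_inj by blast
      with uv show ?thesis by auto
    next
      case 3
      with char_eq eq have "x ^ 3 ^ i = y ^ 3 ^ i"
        by (simp add: on_nonsquares)
      then show ?thesis
        by (rule injD[OF inj_power_three_power_char3[OF three]])
    qed
  qed
  then show ?thesis
    unfolding permutation_polynomial_def f_def[symmetric] by (simp add: bij_def finite_UNIV_inj_surj)
qed

end
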